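(* Let $n\ge 1$ and let $W^0_{n+2}(p,p_1,\dots,p_{n+1})$ be the genus-$0$ solution of the topological recursion with Euler characteristic $\chi=-n$. Let $\mathbf{(1)}=|\vee|$ be the planar binary tree with one vertex and write, in the Loday--Ronco algebra $k[Y^\infty]$ ($k=\mathbb{Q}$), $$\mathbf{(1)}\ast\mathbf{(1)}\ast\cdots\ast\mathbf{(1)}\ (n\text{ factors})=\sum_{t\in Y^n}c_t\,t .$$ Then $W^0_{n+2}(p,p_1,\dots,p_{n+1})$ is represented by this linear combination followed by the sum over all permutations of the leaf labels, that is, $$W^0_{n+2}(p,p_1,\dots,p_{n+1})=\sum_{\sigma}\ \sum_{t\in Y^n}c_t\,\mathrm{ev}_{t,\sigma}(p),$$ where $\sigma$ runs over all $(n+1)!$ bijective labelings of the $n+1$ leaves by $p_1,\dots,p_{n+1}$ and $\mathrm{ev}_{t,\sigma}(p)$ is the term obtained from $t$ by identifying every vertex with a recursion kernel and every leaf with a cylinder $W^0_2$.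
   Context: Planar binary trees. A planar binary tree is a rooted planar tree all of whose internal vertices are trivalent (one edge down, an ordered left and right edge up). Its order $|t|$ is the number of internal vertices; a tree of order $n$ has $n+1$ leaves, ordered left to right. $Y^n$ is the set of planar binary trees of order $n$; $Y^0=\{|\}$, where $|$ is the tree with a single edge and no vertex. The grafting $t_1\vee t_2$ is the tree with left branch $t_1$ and right branch $t_2$ at the root vertex; every tree of order $n\ge1$ is uniquely $t_1\vee t_2$ with $|t_1|+|t_2|+1=n$. $k[Y^\infty]=\bigoplus_{n\ge 0}k[Y^n]$ is the vector space with basis all planar binary trees, with the associative bilinear Loday--Ronco product $\ast$, determined by $t\ast|=|\ast t=t$ and, for $t=t_1\vee t_2$, $t'=t_1'\vee t_2'$, $$t\ast t'=t_1\vee(t_2\ast t')+(t\ast t_1')\vee t_2'$$ ($\vee$ extended bilinearly). Genus-$0$ topological recursion. One is given a spectral curve with a meromorphic function $x$ having branch points $\alpha$; near a branch point each point $q$ has a conjugate point $\bar q$ with $x(q)=x(\bar q)$. One is given the cylinder $W^0_2(\cdot,\cdot)$ (a symmetric bidifferential) and a recursion kernel $K_p(q,\bar q)$. For an expression $F(q,\bar q)$, write $K_p(q,\bar q)F(q,\bar q)$ for $\sum_\alpha \mathrm{Res}_{q\to\alpha}K_p(q,\bar q)F(q,\bar q)$; this is linear in $F$. For $n\ge1$ and $K=\{p_1,\dots,p_{n+1}\}$, $W^0_{n+2}$ is defined recursively by $$W^0_{n+2}(p,K)=K_p(q,\bar q)\sum_{L\sqcup M=K,\ L,M\neq\emptyset}W^0_{|L|+1}(q,L)\,W^0_{|M|+1}(\bar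 q,M),$$ the sum being over ordered pairs $(L,M)$ of complementary nonempty subsets of $K$ (terms with $|L|=1$ or $|M|=1$ involve $W_2^0$). Evaluation of a labeled tree. For a tree $t$ with a bijective labeling $\sigma$ of its leaves by variables, define $\mathrm{ev}_{t,\sigma}(x)$, with root variable $x$, recursively: if $t=|$ with leaf label $a$, $\mathrm{ev}_{t,\sigma}(x)=W^0_2(x,a)$; if $t=t_1\vee t_2$ with restricted labelings $\sigma_1,\sigma_2$, $\mathrm{ev}_{t,\sigma}(x)=K_x(q,\bar q)\,\mathrm{ev}_{t_1,\sigma_1}(q)\,\mathrm{ev}_{t_2,\sigma_2}(\bar q)$. *)

theory Defs
  imports
    "HOL-Complex_Analysis.Complex_Analysis"
    "HOL-Library.Poly_Mapping"
    "HOL-Combinatorics.Permutations"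
begin

section \<open>Planar binary trees and the Loday--Ronco product\<close>

datatype pbtree = Edge | Graft pbtree pbtree

fun tree_order :: "pbtree \<Rightarrow> nat" where
  "tree_order Edge = 0"
| "tree_order (Graft t1 t2) = tree_order t1 + tree_order t2 + 1"

definition trees :: "nat \<Rightarrow> pbtree set" where
  "trees n = {t. tree_order t = n}"

text \<open>The vector space of rational linear combinations of trees is the type
  \<^typ>\<open>pbtree \<Rightarrow>\<^sub>0 rat\<close> of finitely supported functions.\<close>

definition tree_basis :: "pbtree \<Rightarrow> (pbtree \<Rightarrow>\<^sub>0 rat)" where
  "tree_basis t = Poly_Mapping.single t 1"

definition bilinear_ext ::
  "(pbtree \<Rightarrow> pbtree \<Rightarrow> (pbtree \<Rightarrow>\<^sub>0 rat)) \<Rightarrow>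
   (pbtree \<Rightarrow>\<^sub>0 rat) \<Rightarrow> (pbtree \<Rightarrow>\<^sub>0 rat) \<Rightarrow> (pbtree \<Rightarrow>\<^sub>0 rat)" where
  "bilinear_ext f a b =
     (\<Sum>s\<in>Poly_Mapping.keys a. \<Sum>t\<in>Poly_Mapping.keys b.
        Poly_Mapping.map ((*) (Poly_Mapping.lookup a s * Poly_Mapping.lookup b t)) (f s t))"

definition graft :: "(pbtree \<Rightarrow>\<^sub>0 rat) \<Rightarrow> (pbtree \<Rightarrow>\<^sub>0 rat) \<Rightarrow> (pbtree \<Rightarrow>\<^sub>0 rat)" where
  "graft = bilinear_ext (\<lambda>t1 t2. tree_basis (Graft t1 t2))"

function lr_tree :: "pbtree \<Rightarrow> pbtree \<Rightarrow> (pbtree \<Rightarrow>\<^sub>0 rat)" where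
  "lr_tree t Edge = tree_basis t"
| "lr_tree Edge (Graft t1' t2') = tree_basis (Graft t1' t2')"
| "lr_tree (Graft t1 t2) (Graft t1' t2') =
     graft (tree_basis t1) (lr_tree t2 (Graft t1' t2')) +
     graft (lr_tree (Graft t1 t2) t1') (tree_basis t2')"
  by pat_completeness auto
termination by (relation "Wellfounded.measure (\<lambda>(s, t). size s + size t)") auto

definition lr_mult ::
  "(pbtree \<Rightarrow>\<^sub>0 rat) \<Rightarrow> (pbtree \<Rightarrow>\<^sub>0 rat) \<Rightarrow> (pbtree \<Rightarrow>\<^sub>0 rat)" where
  "lr_mult = bilinear_ext lr_tree"

text \<open>The product is associative with unit \<^term>\<open>tree_basis Edge\<close>, so the bracketing of a power is
  immaterial.\<close>

fun lr_power :: "(pbtree \<Rightarrow>\<^sub>0 rat) \<Rightarrow> nat \<Rightarrow> (pbtree \<Rightarrow>\<^sub>0 rat)" where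
  "lr_power a 0 = tree_basis Edge"
| "lr_power a (Suc n) = lr_mult a (lr_power a n)"

definition one_vertex :: "pbtree \<Rightarrow>\<^sub>0 rat" where
  "one_vertex = tree_basis (Graft Edge Edge)"


section \<open>Riemann surfaces\<close>

text \<open>A chart is a pair of its domain and its coordinate map; the surface is the whole type.\<close>

type_synonym 'a chart = "'a set \<times> ('a \<Rightarrow> complex)"

definition chart_inv :: "'a chart \<Rightarrow> complex \<Rightarrow> 'a" where
  "chart_inv c = inv_into (fst c) (snd c)"

definition riemann_surface :: "'a::t2_space chart set \<Rightarrow> bool" where
  "riemann_surface A \<longleftrightarrow>
     connected (UNIV :: 'a set) \<and> (\<Union>c\<in>A. fst c) = UNIV \<and>
     (\<forall>c\<in>A. open (fst c) \<and> open (snd c ` fst c) \<and>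
            homeomorphism (fst c) (snd c ` fst c) (snd c) (chart_inv c)) \<and>
     (\<forall>c\<in>A. \<forall>d\<in>A. (snd d \<circ> chart_inv c) holomorphic_on (snd c ` (fst c \<inter> fst d)))"

definition surface_holomorphic :: "'a chart set \<Rightarrow> 'a set \<Rightarrow> ('a \<Rightarrow> complex) \<Rightarrow> bool" where
  "surface_holomorphic A V f \<longleftrightarrow>
     (\<forall>c\<in>A. (f \<circ> chart_inv c) holomorphic_on (snd c ` (fst c \<inter> V)))"

definition surface_meromorphic :: "'a chart set \<Rightarrow> ('a \<Rightarrow> complex) \<Rightarrow> bool" where
  "surface_meromorphic A f \<longleftrightarrow>
     (\<forall>c\<in>A. (f \<circ> chart_inv c) meromorphic_on (snd c ` fst c))"

text \<open>Here the values are normalised as well: a removable singularity carries its limit, a pole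
  carries the value 0.\<close>

definition surface_nicely_meromorphic :: "'a chart set \<Rightarrow> ('a \<Rightarrow> complex) \<Rightarrow> bool" where
  "surface_nicely_meromorphic A f \<longleftrightarrow>
     (\<forall>c\<in>A. (f \<circ> chart_inv c) nicely_meromorphic_on (snd c ` fst c))"

definition surface_holomorphic_map ::
  "'a::topological_space chart set \<Rightarrow> 'a set \<Rightarrow> ('a \<Rightarrow> 'a) \<Rightarrow> bool" where
  "surface_holomorphic_map A V f \<longleftrightarrow>
     continuous_on V f \<and>
     (\<forall>c\<in>A. \<forall>d\<in>A. (snd d \<circ> f \<circ> chart_inv c) holomorphic_on
        (snd c ` {q \<in> fst c \<inter> V. f q \<in> fst d}))"


section \<open>Spectral curves\<close>

text \<open>
  All differentials are represented by their coefficients with respect to \<open>dx\<close>, where \<open>x\<close> is the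
  given (nonconstant) meromorphic function; every meromorphic 1-form is \<open>f dx\<close> for a
  unique meromorphic function \<open>f\<close>. So \<open>W\<^sub>2(p,q) = cyl S p q dx(p) dx(q)\<close> and
  \<open>K\<^sub>p(q,q') = rec_kernel S p q q' dx(p) / dx(q)\<close>. On conjugate points \<open>x(q) = x(conjugate S q)\<close>,
  hence \<open>dx(conjugate S q) = dx(q)\<close>.  Coefficients are only meaningful away from the zeros of \<open>dx\<close>,
  that is, away from the branch points.
  The function \<open>conjugate S\<close> is only relevant near the branch points, and
  \<open>rec_kernel S p q q'\<close> only for \<open>q\<close> near a branch point and \<open>q'\<close> conjugate to \<open>q\<close>.
\<close>

record 'a spectral_data =
  atlas :: "'a chart set"
  xfun :: "'a \<Rightarrow> complex"
  conjugate :: "'a \<Rightarrow> 'a"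
  cyl :: "'a \<Rightarrow> 'a \<Rightarrow> complex"
  rec_kernel :: "'a \<Rightarrow> 'a \<Rightarrow> 'a \<Rightarrow> complex"

definition branch_points :: "'a spectral_data \<Rightarrow> 'a set" where
  "branch_points S =
     {a. \<exists>c\<in>atlas S. a \<in> fst c \<and> \<not> is_pole (xfun S \<circ> chart_inv c) (snd c a) \<and>
           deriv (xfun S \<circ> chart_inv c) (snd c a) = 0}"

definition conj_nbhd :: "'a::t2_space spectral_data \<Rightarrow> 'a \<Rightarrow> 'a set \<Rightarrow> bool" where
  "conj_nbhd S a V \<longleftrightarrow>
     open V \<and> a \<in> V \<and> surface_holomorphic_map (atlas S) V (conjugate S) \<and>
     (\<forall>q\<in>V. {r\<in>V. xfun S r = xfun S q} = {q, conjugate S q} \<and> (conjugate S q = q \<longleftrightarrow> q = a))"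

text \<open>
  For \<open>q\<close> near the branch point \<open>a\<close>, the kernel is holomorphic in \<open>(p,q)\<close> except for singularities
  at \<open>q = a\<close>, \<open>p = q\<close> and \<open>p = conjugate S q\<close> (and at the zeros \<open>p\<close> of \<open>dx\<close>, because coefficients
  relative to \<open>dx\<close> are used).  Joint holomorphy is expressed as continuity together with
  separate holomorphy.
\<close>

definition kernel_regular :: "'a::t2_space spectral_data \<Rightarrow> 'a \<Rightarrow> 'a set \<Rightarrow> bool" where
  "kernel_regular S a V \<longleftrightarrow>
     (let D = {(p, q). p \<notin> branch_points S \<and> q \<in> V - {a} \<and> p \<noteq> q \<and> p \<noteq> conjugate S q};
          k = (\<lambda>p q. rec_kernel S p q (conjugate S q))
      in continuous_on D (\<lambda>(p, q). k p q) \<and>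
         (\<forall>q. surface_holomorphic (atlas S) {p. (p, q) \<in> D} (\<lambda>p. k p q)) \<and>
         (\<forall>p. surface_holomorphic (atlas S) {q. (p, q) \<in> D} (\<lambda>q. k p q)))"

definition spectral_curve :: "'a::t2_space spectral_data \<Rightarrow> bool" where
  "spectral_curve S \<longleftrightarrow>
     riemann_surface (atlas S) \<and>
     surface_nicely_meromorphic (atlas S) (xfun S) \<and>
     finite (branch_points S) \<and>
     (\<forall>p q. cyl S p q = cyl S q p) \<and>
     (\<forall>q. q \<notin> branch_points S \<longrightarrow> surface_meromorphic (atlas S) (\<lambda>p. cyl S p q)) \<and>
     (\<forall>a\<in>branch_points S. \<exists>V. conj_nbhd S a V \<and> kernel_regular S a V)"


section \<open>Topological recursion in genus 0\<close>

text \<open>The residue at \<open>a\<close> of the differential \<open>f dx\<close>; it does not depend on the choice of the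
  chart around \<open>a\<close>.\<close>

definition residue_dx :: "'a spectral_data \<Rightarrow> ('a \<Rightarrow> complex) \<Rightarrow> 'a \<Rightarrow> complex" where
  "residue_dx S f a =
     (let c = (SOME c. c \<in> atlas S \<and> a \<in> fst c)
      in residue (\<lambda>z. f (chart_inv c z) * deriv (xfun S \<circ> chart_inv c) z) (snd c a))"

definition kernel_op :: "'a spectral_data \<Rightarrow> 'a \<Rightarrow> ('a \<Rightarrow> 'a \<Rightarrow> complex) \<Rightarrow> complex" where
  "kernel_op S p F =
     (\<Sum>a\<in>branch_points S.
        residue_dx S (\<lambda>q. rec_kernel S p q (conjugate S q) * F q (conjugate S q)) a)"

text \<open>
  \<open>W0 S p [p\<^sub>1, \<dots>, p\<^sub>m]\<close> is the coefficient of \<open>W\<^sup>0\<close> with \<open>m + 1\<close> arguments at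
  \<open>(p, p\<^sub>1, \<dots>, p\<^sub>m)\<close>. Subsets of the variables are given as sets of positions, so that
  variables with equal values stay distinguished. The value for the empty list is never used.
\<close>

function W0 :: "'a spectral_data \<Rightarrow> 'a \<Rightarrow> 'a list \<Rightarrow> complex" where
  "W0 S p [] = 0"
| "W0 S p [a] = cyl S p a"
| "W0 S p (a # b # ps) =
     kernel_op S p (\<lambda>q q'.
       \<Sum>(L, M) \<in> {(L, M). L \<union> M = {..<length (a # b # ps)} \<and> L \<inter> M = {} \<and> L \<noteq> {} \<and> M \<noteq> {}}.
         W0 S q (nths (a # b # ps) L) * W0 S q' (nths (a # b # ps) M))"
  by pat_completeness auto
termination
proof (relation "Wellfounded.measure (\<lambda>(S, p, ps). length ps)", goal_cases)
  case 1
  then show ?case by simp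
next
  have *: "length (nths xs L) < length xs"
    if "L \<union> M = {..<length xs}" "L \<inter> M = {}" "M \<noteq> {}" for xs :: "'a list" and L M
  proof -
    have "{i. i < length xs \<and> i \<in> L} \<subset> {..<length xs}" using that by auto
    then have "card {i. i < length xs \<and> i \<in> L} < card {..<length xs}"
      by (intro psubset_card_mono) auto
    then show ?thesis by (simp add: length_nths)
  qed
  {
    case (2 S p a b ps q q' x L M)
    then show ?case using *[of L M "a # b # ps"] by (auto split: prod.splits)
  next
    case (3 S p a b ps q q' x L M)
    then show ?case using *[of M L "a # b # ps"] by (auto simp: Un_commute Int_commute split: prod.splits)
  }
qed

text \<open>A labeling of the leaves of \<open>t\<close> is the list of the labels from left to right, of length
  \<open>tree_order t + 1\<close>.\<close>

fun ev :: "'a spectral_data \<Rightarrow> pbtree \<Rightarrow> 'a list \<Rightarrow> 'a \<Rightarrow> complex" where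
  "ev S Edge ls x = cyl S x (hd ls)"
| "ev S (Graft t1 t2) ls x =
     kernel_op S x (\<lambda>q q'.
       ev S t1 (take (tree_order t1 + 1) ls) q * ev S t2 (drop (tree_order t1 + 1) ls) q')"

end

theory Submission
  imports Defs "HOL-Combinatorics.Multiset_Permutations"
begin

text \<open>
  Multiplying a tree from the left by the one-vertex tree gives the sum of all trees which become
  that tree when their leftmost leaf is deleted. Hence the \<open>n\<close>-th power is the sum of all
  trees of order \<open>n\<close>, each with coefficient 1. Unfolding the recursion, \<open>W0\<close> is the
  sum of the evaluations of all labeled trees: a decomposition of the variables into \<open>L\<close> and
  \<open>M\<close> together with labeled trees on \<open>L\<close> and \<open>M\<close> is the same as a labeled
  grafting. The one analytic point is that the residues are additive, for which the integrands must
  have isolated singularities at the branch points. For an evaluated tree with a vertex this holds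
  because it is a contour integral of the kernel, hence holomorphic off the branch points by Morera
  and Fubini.
\<close>

section \<open>Powers of the one-vertex tree\<close>


lemma in_trees: "t \<in> trees n \<longleftrightarrow> tree_order t = n"
  by (simp add: trees_def)

lemma finite_trees: "finite (trees n)"
proof (induction n rule: less_induct)
  case (less n)
  let ?B = "\<Union>m<n. trees m"
  have "trees n \<subseteq> insert Edge (case_prod Graft ` (?B \<times> ?B))"
  proof
    fix t assume "t \<in> trees n"
    then show "t \<in> insert Edge (case_prod Graft ` (?B \<times> ?B))"
      by (cases t) (auto simp: trees_def image_iff)
  qed
  moreover have "finite ?B" using less by auto
  ultimately show ?case by (meson finite_insert finite_SigmaI finite_imageI finite_subset)
qed

lemma trees_0: "trees 0 = {Edge}"
proof -
  have "tree_order t = 0 \<longleftrightarrow> t = Edge" for t by (cases t) auto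
  then show ?thesis by (auto simp: trees_def)
qed

lemma lookup_bilinear_ext:
  "Poly_Mapping.lookup (bilinear_ext f a b) u =
     (\<Sum>s\<in>Poly_Mapping.keys a. \<Sum>t\<in>Poly_Mapping.keys b.
        Poly_Mapping.lookup a s * Poly_Mapping.lookup b t * Poly_Mapping.lookup (f s t) u)"
  unfolding bilinear_ext_def
  by (auto simp: lookup_sum Poly_Mapping.map.rep_eq when_def intro!: sum.cong)

lemma lookup_tree_basis: "Poly_Mapping.lookup (tree_basis t) u = (if u = t then 1 else 0)"
  by (auto simp: tree_basis_def lookup_single when_def)

lemma keys_tree_basis [simp]: "Poly_Mapping.keys (tree_basis t) = {t}"
  by (auto simp: tree_basis_def)

lemma lookup_graft_left_basis:
  "Poly_Mapping.lookup (graft (tree_basis t1) b) u =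
     (case u of Edge \<Rightarrow> 0 | Graft u1 u2 \<Rightarrow> if u1 = t1 then Poly_Mapping.lookup b u2 else 0)"
  by (auto simp: graft_def lookup_bilinear_ext lookup_tree_basis in_keys_iff mult_delta_right split: pbtree.splits)

lemma lookup_graft_right_basis:
  "Poly_Mapping.lookup (graft a (tree_basis t2)) u =
     (case u of Edge \<Rightarrow> 0 | Graft u1 u2 \<Rightarrow> if u2 = t2 then Poly_Mapping.lookup a u1 else 0)"
  by (auto simp: graft_def lookup_bilinear_ext lookup_tree_basis in_keys_iff mult_delta_right split: pbtree.splits)

text \<open>The vertex below the leftmost leaf disappears and its right branch takes its place.
  \<open>Edge\<close> has no vertex to remove; its value is a default, excluded by
  \<open>u \<noteq> Edge\<close> where the product is computed.\<close>

fun delete_leftmost_leaf :: "pbtree \<Rightarrow> pbtree" where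
  "delete_leftmost_leaf Edge = Edge"
| "delete_leftmost_leaf (Graft Edge t) = t"
| "delete_leftmost_leaf (Graft (Graft s1 s2) t) = Graft (delete_leftmost_leaf (Graft s1 s2)) t"

lemma tree_order_delete_leftmost_leaf: "tree_order (delete_leftmost_leaf t) = tree_order t - 1"
  by (induction t rule: delete_leftmost_leaf.induct) auto

text \<open>For \<open>t = Graft t1 t2\<close> the first summand of the product is
  \<open>Graft Edge t\<close>, where the deletion happens at the root; the second grafts the product
  with \<open>t1\<close> onto \<open>t2\<close>, where the deletion continues in the left branch. By
  induction \<open>Edge\<close> has coefficient 0 in the product with \<open>t1\<close>, so the two
  kinds do not overlap.\<close>

lemma lookup_lr_tree_one_vertex:
  "Poly_Mapping.lookup (lr_tree (Graft Edge Edge) t) u =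
     (if u \<noteq> Edge \<and> delete_leftmost_leaf u = t then 1 else 0)"
proof (induction t arbitrary: u)
  case Edge
  then show ?case
    by (cases u rule: delete_leftmost_leaf.cases) (auto simp: lookup_tree_basis)
next
  case (Graft t1 t2)
  show ?case
    by (cases u rule: delete_leftmost_leaf.cases)
      (auto simp: lookup_add lookup_graft_left_basis lookup_graft_right_basis lookup_tree_basis Graft)
qed

text \<open>A tree of order \<open>n + 1\<close> receives a contribution from exactly one tree of
  order \<open>n\<close>, its own deletion, so no coefficient exceeds 1.\<close>

lemma lookup_lr_power_one_vertex:
  "Poly_Mapping.lookup (lr_power one_vertex n) u = (if tree_order u = n then 1 else 0)"
proof (induction n arbitrary: u)
  case 0
  then show ?case using trees_0 in_trees[of u 0] by (simp add: lookup_tree_basis)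
next
  case (Suc n)
  have keys: "Poly_Mapping.keys (lr_power one_vertex n) = trees n"
    by (rule set_eqI) (simp add: in_keys_iff Suc in_trees)
  have "Poly_Mapping.lookup (lr_power one_vertex (Suc n)) u =
      (\<Sum>t\<in>trees n. if u \<noteq> Edge \<and> delete_leftmost_leaf u = t then 1 else 0)"
    by (simp add: lr_mult_def lookup_bilinear_ext keys) 
      (simp add: one_vertex_def lookup_tree_basis lookup_lr_tree_one_vertex Suc[unfolded one_vertex_def] in_trees)
  also have "\<dots> = (if u \<noteq> Edge \<and> delete_leftmost_leaf u \<in> trees n then 1 else 0)"
    by (cases "u = Edge") (simp_all add: finite_trees)
  \<comment> \<open>For \<open>n = 0\<close> the tree \<open>Edge\<close> would pass the test on the
    deletion because \<open>0 - 1 = 0\<close>; the condition \<open>u \<noteq> Edge\<close> removes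
    it.\<close>
  also have "\<dots> = (if tree_order u = Suc n then 1 else 0)"
    using tree_order_delete_leftmost_leaf[of u] by (cases u) (auto simp: in_trees)
  finally show ?case .
qed

lemma lr_power_one_vertex_eq_sum:
  "lr_power one_vertex n = (\<Sum>t\<in>trees n. Poly_Mapping.single t 1)"
  by (rule poly_mapping_eqI)
    (auto simp: lookup_sum lookup_single when_def lookup_lr_power_one_vertex finite_trees in_trees)

section \<open>Labelings of trees\<close>

text \<open>A permutation is determined by its list of values; the inverse witness extends by the
  identity beyond \<open>N\<close>, as \<open>permutes\<close> demands.\<close>

lemma sum_permutes_eq_sum_permutations_of_set:
  fixes g :: "nat list \<Rightarrow> 'b::comm_monoid_add"
  shows "(\<Sum>\<sigma> | \<sigma> permutes {..<N}. g (map \<sigma> [0..<N])) = (\<Sum>zs\<in>permutations_of_set {..<N}. g zs)"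
proof (rule sum.reindex_bij_witness
    [where j = "\<lambda>\<sigma>. map \<sigma> [0..<N]" and i = "\<lambda>zs i. if i < N then zs ! i else i"])
  fix \<sigma> assume "\<sigma> \<in> {\<sigma>. \<sigma> permutes {..<N}}"
  then have s: "\<sigma> permutes {..<N}" by simp
  then show "(\<lambda>i. if i < N then map \<sigma> [0..<N] ! i else i) = \<sigma>"
    by (auto simp: permutes_def)
  show "map \<sigma> [0..<N] \<in> permutations_of_set {..<N}"
    using s by (auto intro!: permutations_of_setI simp: distinct_map permutes_image permutes_inj_on
        lessThan_atLeast0[symmetric])
next
  fix zs assume zs: "zs \<in> permutations_of_set {..<N}"
  then have set: "set zs = {..<N}" and dist: "distinct zs"
    by (auto dest: permutations_of_setD)
  then have len: "length zs = N" using distinct_card by fastforce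
  show "map (\<lambda>i. if i < N then zs ! i else i) [0..<N] = zs"
    using len by (intro nth_equalityI) auto
  have "bij_betw ((!) zs) {..<N} {..<N}"
    using bij_betw_nth[OF dist refl refl] set len by simp
  then have "bij_betw (\<lambda>i. if i < N then zs ! i else i) {..<N} {..<N}"
    by (subst bij_betw_cong[where g = "(!) zs"]) auto
  then show "(\<lambda>i. if i < N then zs ! i else i) \<in> {\<sigma>. \<sigma> permutes {..<N}}"
    by (intro CollectI bij_imp_permutes) auto
qed auto

text \<open>This turns one step of the recursion into a root vertex. Passing to
  \<open>(xs @ ys, Graft s t)\<close> loses nothing: the order of \<open>s\<close> tells where to
  cut, and distinctness of \<open>is\<close> lets the blocks be read off from the labels. With at
  least two labels the tree is never \<open>Edge\<close>, the case absent on the right-hand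
  side.\<close>

lemma sum_partitions_eq_sum_trees:
  fixes g :: "'i list \<Rightarrow> pbtree \<Rightarrow> 'i list \<Rightarrow> pbtree \<Rightarrow> 'b::comm_monoid_add"
  assumes dist: "distinct is" and len: "length is \<ge> 2"
  defines "Part \<equiv> {(L, M). L \<union> M = {..<length is} \<and> L \<inter> M = {} \<and> L \<noteq> {} \<and> M \<noteq> {}}"
  defines "Lab \<equiv> \<lambda>L. permutations_of_set (set (nths is L)) \<times> trees (length (nths is L) - 1)"
  shows "(\<Sum>((L, M), (xs, s), (ys, t))\<in>(SIGMA (L, M):Part. Lab L \<times> Lab M). g xs s ys t) =
    (\<Sum>(zs, u)\<in>permutations_of_set (set is) \<times> trees (length is - 1).
       case u of Graft s t \<Rightarrow> g (take (tree_order s + 1) zs) s (drop (tree_order s + 1) zs) t)"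
proof -
  \<comment> \<open>The inverse of taking the labels at a set of positions: it recovers a block from
    the labels used on it.\<close>
  define pos where "pos xs = {i. i < length is \<and> is ! i \<in> set xs}" for xs
  have set_pos: "set (nths is (pos xs)) = set xs" if "set xs \<subseteq> set is" for xs
    using that by (auto simp: set_nths pos_def in_set_conv_nth) (metis nth_mem subsetD in_set_conv_nth)
  have pos_set: "pos xs = L" if "set xs = set (nths is L)" "L \<subseteq> {..<length is}" for xs L
    using that dist by (auto simp: pos_def set_nths nth_eq_iff_index_eq subset_iff)
  have len_nths: "length (nths is (pos xs)) = length xs" if "set xs \<subseteq> set is" "distinct xs" for xs
    using set_pos[OF that(1)] that dist distinct_card[of xs] distinct_card[of "nths is (pos xs)"] by simp
  have lab: "distinct xs \<and> set xs = set (nths is L) \<and> length xs = length (nths is L)"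
    if "(xs, s) \<in> Lab L" for xs s L
  proof -
    have "distinct xs" "set xs = set (nths is L)" 
      using that by (auto simp: Lab_def dest: permutations_of_setD)
    then show ?thesis using distinct_card[of xs] distinct_card[of "nths is L"] dist by simp
  qed
  \<comment> \<open>Nonemptiness of \<open>L\<close> matters: for the empty block, truncated
    subtraction would pair the empty list with \<open>Edge\<close>, which has one leaf.\<close>
  have ord: "length xs = tree_order s + 1" if "(L, M) \<in> Part" "(xs, s) \<in> Lab L" for L M xs s
  proof -
    have "L \<noteq> {}" "L \<subseteq> {..<length is}" using that(1) by (auto simp: Part_def)
    then obtain i where "i \<in> L" "i < length is" by blast
    then have "set (nths is L) \<noteq> {}" by (auto simp: set_nths)
    then show ?thesis using that(2) lab[OF that(2)] by (cases xs) (auto simp: Lab_def in_trees)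
  qed
  show ?thesis
  proof (rule sum.reindex_bij_witness[where
      j = "\<lambda>((L, M), (xs, s), (ys, t)). (xs @ ys, Graft s t)" and
      i = "\<lambda>(zs, u). case u of Graft s t \<Rightarrow>
         let xs = take (tree_order s + 1) zs; ys = drop (tree_order s + 1) zs
         in ((pos xs, pos ys), (xs, s), (ys, t))"], goal_cases)
    case (1 w)
    then obtain L M xs s ys t where w: "w = ((L, M), (xs, s), (ys, t))" and LM: "(L, M) \<in> Part"
      and xs: "(xs, s) \<in> Lab L" and ys: "(ys, t) \<in> Lab M" by auto
    have "L \<subseteq> {..<length is}" "M \<subseteq> {..<length is}" using LM by (auto simp: Part_def)
    then have "pos xs = L" "pos ys = M" "length xs = tree_order s + 1"
      using lab[OF xs] lab[OF ys] pos_set ord[OF LM xs] by auto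
    then show ?case by (simp add: w)
  next
    case (2 w)
    then obtain L M xs s ys t where w: "w = ((L, M), (xs, s), (ys, t))" and LM: "(L, M) \<in> Part"
      and xs: "(xs, s) \<in> Lab L" and ys: "(ys, t) \<in> Lab M" by auto
    have LM': "(M, L) \<in> Part" using LM by (auto simp: Part_def)
    have "set xs \<union> set ys = set is" "set xs \<inter> set ys = {}"
      using lab[OF xs] lab[OF ys] LM dist
      by (auto simp: Part_def set_nths in_set_conv_nth nth_eq_iff_index_eq) blast+
    then have zs: "xs @ ys \<in> permutations_of_set (set is)"
      using lab[OF xs] lab[OF ys] by (intro permutations_of_setI) auto
    then have "length (xs @ ys) = length is"
      using dist length_finite_permutations_of_set[of "xs @ ys" "set is"] by (simp add: distinct_card)
    then show ?case using zs ord[OF LM xs] ord[OF LM' ys] by (simp add: w in_trees)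
  next
    case (3 w)
    then obtain zs s t where w: "w = (zs, Graft s t)" and zs: "distinct zs" "set zs = set is"
      and order: "tree_order s + tree_order t + 1 = length is - 1"
      using len by (cases w; cases "snd w") (auto simp: in_trees dest: permutations_of_setD)
    then show ?case by (simp add: Let_def)
  next
    case (4 w)
    then obtain zs s t where w: "w = (zs, Graft s t)" and zs: "distinct zs" "set zs = set is"
      and order: "tree_order s + tree_order t + 1 = length is - 1"
      using len by (cases w; cases "snd w") (auto simp: in_trees dest: permutations_of_setD)
    define xs ys where xys: "xs = take (tree_order s + 1) zs" "ys = drop (tree_order s + 1) zs"
    have lz: "length zs = length is" using zs dist by (metis distinct_card)
    have d: "zs = xs @ ys" by (simp add: xys)
    have l: "length xs = tree_order s + 1" "length ys = tree_order t + 1"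
      using lz order by (auto simp: xys)
    have sub: "set xs \<subseteq> set is" "set ys \<subseteq> set is" "distinct xs" "distinct ys"
      "set xs \<inter> set ys = {}" "set xs \<union> set ys = set is"
      using zs by (auto simp: d)
    have "(pos xs, pos ys) \<in> Part"
    proof -
      have "pos xs \<union> pos ys = {..<length is}" "pos xs \<inter> pos ys = {}"
        using sub(5,6) by (auto simp: pos_def)
      \<comment> \<open>A tree has one more leaf than vertices, so both halves of the label list are
        nonempty.\<close>
      moreover have "pos xs \<noteq> {}" "pos ys \<noteq> {}"
        using l set_pos[OF sub(1)] set_pos[OF sub(2)] by auto
      ultimately show ?thesis by (simp add: Part_def)
    qed
    moreover have "(xs, s) \<in> Lab (pos xs)" "(ys, t) \<in> Lab (pos ys)"
      using sub l by (auto simp: Lab_def set_pos len_nths in_trees)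
    ultimately show ?case by (simp add: w Let_def xys)
  next
    case (5 w)
    then obtain L M xs s ys t where w: "w = ((L, M), (xs, s), (ys, t))" and LM: "(L, M) \<in> Part"
      and xs: "(xs, s) \<in> Lab L" and ys: "(ys, t) \<in> Lab M" by auto
    then show ?case using ord[OF LM xs] by (simp add: w)
  qed
qed

section \<open>Contour integrals and residues\<close>


text \<open>Parametrized, this is an integral over a compact interval; the continuous derivative of
  \<open>g\<close> keeps the integrand jointly continuous.\<close>

lemma continuous_on_contour_integral_param:
  assumes "continuous_on (U \<times> path_image g) (\<lambda>(w, \<zeta>). k w \<zeta>)" "path g"
    and "continuous_on {0..1} (\<lambda>t. vector_derivative g (at t))"
  shows "continuous_on U (\<lambda>w. contour_integral g (k w))"
proof -
  have g: "continuous_on {0..1} g" using assms(2) by (simp add: path_def)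
  have "continuous_on (U \<times> {0..1}) (\<lambda>x. (fst x, g (snd x)))"
    by (intro continuous_on_Pair continuous_on_fst continuous_on_id continuous_on_compose2[OF g]
        continuous_on_snd) auto
  then have "continuous_on (U \<times> {0..1}) (\<lambda>x. (\<lambda>(w, \<zeta>). k w \<zeta>) (fst x, g (snd x)))"
    by (rule continuous_on_compose2[OF assms(1)]) (auto simp: path_image_def)
  moreover have "continuous_on (U \<times> {0..1}) (\<lambda>x::_ \<times> real. vector_derivative g (at (snd x)))"
    by (rule continuous_on_compose2[OF assms(3)]) (auto intro: continuous_on_snd continuous_on_id)
  ultimately have "continuous_on (U \<times> cbox 0 (1::real)) 
      (\<lambda>(w, t). k w (g t) * vector_derivative g (at t))"
    by (auto simp: case_prod_unfold intro: continuous_on_mult)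
  from integral_continuous_on_param[OF this] show ?thesis
    by (simp add: contour_integral_integral)
qed

text \<open>By Morera it suffices that integrals over triangles in \<open>U\<close> vanish. Fubini
  moves the triangle integral inside, where Cauchy's theorem makes it vanish for each fixed point of
  the contour.\<close>

lemma holomorphic_on_contour_integral_param:
  assumes "open U" "valid_path g"
    and gcon: "continuous_on {0..1} (\<lambda>t. vector_derivative g (at t))"
    and kcon: "continuous_on (U \<times> path_image g) (\<lambda>(w, \<zeta>). k w \<zeta>)"
    and hol: "\<And>\<zeta>. \<zeta> \<in> path_image g \<Longrightarrow> (\<lambda>w. k w \<zeta>) holomorphic_on U"
  shows "(\<lambda>w. contour_integral g (k w)) holomorphic_on U"
proof -
  have path: "path g" using assms(2) by (simp add: valid_path_imp_path)
  have "(\<lambda>w. contour_integral g (k w)) analytic_on U"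
  proof (rule Morera_triangle, safe)
    show "continuous_on U (\<lambda>w. contour_integral g (k w))"
      by (rule continuous_on_contour_integral_param[OF kcon path gcon])
    fix a b c assume hull: "convex hull {a, b, c} \<subseteq> U"
    \<comment> \<open>The inner integral after the exchange of order: along one edge in
      \<open>w\<close>, with \<open>\<zeta>\<close> fixed.\<close>
    define I where "I = (\<lambda>a b \<zeta>. contour_integral (linepath a b) (\<lambda>w. k w \<zeta>))"
    have seg: "closed_segment a b \<subseteq> U" "closed_segment b c \<subseteq> U" "closed_segment c a \<subseteq> U"
      unfolding segment_convex_hull by (rule subset_trans[OF hull_mono hull], blast)+
    have swap: "contour_integral (linepath x y) (\<lambda>w. contour_integral g (k w)) = contour_integral g (I x y)"
      and int: "I x y contour_integrable_on g"
      if "closed_segment x y \<subseteq> U" for x y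
    proof -
      have con: "continuous_on (path_image (linepath x y) \<times> path_image g) (\<lambda>(w, \<zeta>). k w \<zeta>)"
        by (rule continuous_on_subset[OF kcon]) (use that in auto)
      show "contour_integral (linepath x y) (\<lambda>w. contour_integral g (k w)) = contour_integral g (I x y)"
        unfolding I_def
        by (intro contour_integral_swap con gcon) (use \<open>valid_path g\<close> in \<open>auto intro!: continuous_intros\<close>)
      \<comment> \<open>Continuity gives integrability along \<open>g\<close>, which is what allows
        the three edges to be added under the integral.\<close>
      have "continuous_on (path_image g) (I x y)"
        unfolding I_def
        by (intro continuous_on_contour_integral_param)
          (use con in \<open>auto intro!: continuous_intros continuous_on_swap_args\<close>)
      then have "continuous_on {0..1} (\<lambda>t. I x y (g t))"
        by (rule continuous_on_compose2) (use path in \<open>auto simp: path_def path_image_def\<close>)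
      then show "I x y contour_integrable_on g"
        unfolding contour_integrable_on
        by (intro integrable_continuous_real continuous_intros gcon)
    qed
    have "contour_integral g (\<lambda>\<zeta>. I a b \<zeta> + I b c \<zeta> + I c a \<zeta>) = contour_integral g (\<lambda>\<zeta>. 0)"
    proof (rule contour_integral_eq)
      fix \<zeta> assume "\<zeta> \<in> path_image g"
      then have "(\<lambda>w. k w \<zeta>) holomorphic_on convex hull {a, b, c}"
        using hol hull holomorphic_on_subset by blast
      from Cauchy_theorem_triangle[OF this]
      have "contour_integral (linepath a b +++ linepath b c +++ linepath c a) (\<lambda>w. k w \<zeta>) = 0"
        by (rule contour_integral_unique)
      moreover have "(\<lambda>w. k w \<zeta>) contour_integrable_on linepath x y" if "closed_segment x y \<subseteq> U" for x y
        using hol[OF \<open>\<zeta> \<in> path_image g\<close>] that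
        by (meson continuous_on_subset contour_integrable_continuous_linepath holomorphic_on_imp_continuous_on)
      ultimately show "I a b \<zeta> + I b c \<zeta> + I c a \<zeta> = 0"
        using seg by (simp add: I_def add.assoc contour_integrable_joinI)
    qed
    moreover have "contour_integral g (\<lambda>\<zeta>. I a b \<zeta> + I b c \<zeta> + I c a \<zeta>) =
        contour_integral g (I a b) + contour_integral g (I b c) + contour_integral g (I c a)"
      using int[OF seg(1)] int[OF seg(2)] int[OF seg(3)]
      by (simp add: contour_integral_add contour_integrable_add)
    ultimately show "contour_integral (linepath a b) (\<lambda>w. contour_integral g (k w)) +
        contour_integral (linepath b c) (\<lambda>w. contour_integral g (k w)) +
        contour_integral (linepath c a) (\<lambda>w. contour_integral g (k w)) = 0"
      using swap seg by simp
  qed (use assms in auto)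
  then show ?thesis by (rule analytic_imp_holomorphic)
qed

lemma residue_add_isolated:
  assumes "isolated_singularity_at f z" "isolated_singularity_at g z"
  shows "residue (\<lambda>z. f z + g z) z = residue f z + residue g z"
proof -
  obtain r s where "r > 0" "s > 0" "f analytic_on ball z r - {z}" "g analytic_on ball z s - {z}"
    using assms by (auto simp: isolated_singularity_at_def)
  then show ?thesis
    by (intro residue_add[of "ball z (min r s)"])
      (auto intro!: analytic_imp_holomorphic elim!: analytic_on_subset)
qed

lemma residue_sum_isolated:
  assumes "\<And>i. i \<in> I \<Longrightarrow> isolated_singularity_at (f i) z"
  shows "residue (\<lambda>w. \<Sum>i\<in>I. f i w) z = (\<Sum>i\<in>I. residue (f i) z)"
  using assms
  by (induction I rule: infinite_finite_induct)
    (auto simp: residue_const residue_add_isolated isolated_singularity_sum)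

section \<open>Charts\<close>

context
  fixes A :: "'a::t2_space chart set" and c :: "'a chart"
  assumes A: "riemann_surface A" and c: "c \<in> A"
begin

lemma chart_inv_left [simp]: "q \<in> fst c \<Longrightarrow> chart_inv c (snd c q) = q"
  using A c by (auto simp: riemann_surface_def homeomorphism_def)

lemma continuous_on_chart_inv: "continuous_on (snd c ` fst c) (chart_inv c)"
  using A c by (auto simp: riemann_surface_def homeomorphism_def)

text \<open>A chart is a homeomorphism onto an open subset of the plane, so relatively open images
  are open.\<close>

lemma open_chart_image:
  assumes "open N"
  shows "open (snd c ` (fst c \<inter> N))"
proof -
  have h: "homeomorphism (fst c) (snd c ` fst c) (snd c) (chart_inv c)"
    and o: "open (snd c ` fst c)"
    using A c by (auto simp: riemann_surface_def)
  have "openin (top_of_set (snd c ` fst c)) (snd c ` (fst c \<inter> N))"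
    using homeomorphism_imp_open_map[OF h] assms by (auto simp: openin_open)
  then show ?thesis using o openin_open_trans by blast
qed

text \<open>Transfers punctured neighbourhoods on the surface to the coordinate filter in which
  residues and singularities are tested.\<close>

lemma eventually_chart_inv:
  assumes "open N" "a \<in> N" "a \<in> fst c"
  shows "\<forall>\<^sub>F z in at (snd c a). chart_inv c z \<in> fst c \<inter> N - {a} \<and> snd c (chart_inv c z) = z"
proof -
  have "\<forall>\<^sub>F z in at (snd c a). z \<in> snd c ` (fst c \<inter> N) - {snd c a}"
    by (rule eventually_at_in_open) (use assms open_chart_image in auto)
  then show ?thesis by eventually_elim auto
qed

end


section \<open>Linearity of the recursion kernel\<close>

text \<open>The constant \<^const>\<open>residue\<close> is a junk value, and not additive, at a singularity that is
  not isolated.\<close>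

definition isolated_at_branch_points :: "'a spectral_data \<Rightarrow> ('a \<Rightarrow> complex) \<Rightarrow> bool" where
  "isolated_at_branch_points S f \<longleftrightarrow>
     (\<forall>a\<in>branch_points S. \<forall>c\<in>atlas S. a \<in> fst c \<longrightarrow>
        isolated_singularity_at (f \<circ> chart_inv c) (snd c a))"

text \<open>Names the choice made inside \<open>residue_dx\<close>, so that facts about the chosen
  chart apply after folding.\<close>

definition residue_chart :: "'a spectral_data \<Rightarrow> 'a \<Rightarrow> 'a chart" where
  "residue_chart S a = (SOME c. c \<in> atlas S \<and> a \<in> fst c)"

lemma surface_holomorphicD:
  "surface_holomorphic A V f \<Longrightarrow> c \<in> A \<Longrightarrow> W \<subseteq> snd c ` (fst c \<inter> V) \<Longrightarrow>
    (f \<circ> chart_inv c) holomorphic_on W"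
  unfolding surface_holomorphic_def by (blast intro: holomorphic_on_subset)

lemma surface_holomorphic_subset:
  "surface_holomorphic A V f \<Longrightarrow> W \<subseteq> V \<Longrightarrow> surface_holomorphic A W f"
  unfolding surface_holomorphic_def by (blast intro: holomorphic_on_subset)

context
  fixes S :: "'a::t2_space spectral_data"
  assumes S: "spectral_curve S"
begin

section \<open>Conjugation and isolated singularities near the branch points\<close>

lemma riemann_surface_atlas: "riemann_surface (atlas S)"
  using S by (simp add: spectral_curve_def)

lemma finite_branch_points: "finite (branch_points S)"
  using S by (simp add: spectral_curve_def)

text \<open>Taken with \<open>X = {a}\<close>, this separates one branch point from the finitely
  many others.\<close>

lemma open_minus_branch_points: "open (- (branch_points S - X))"
  using finite_branch_points by (intro open_Compl finite_imp_closed finite_Diff)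

lemma chart_at:
  obtains c where "c \<in> atlas S" "a \<in> fst c"
proof -
  have "a \<in> (\<Union>c\<in>atlas S. fst c)" using riemann_surface_atlas by (simp add: riemann_surface_def)
  then show thesis using that by blast
qed

lemma conj_nbhd_at:
  assumes "a \<in> branch_points S"
  obtains V where "conj_nbhd S a V" "kernel_regular S a V"
  using S assms by (auto simp: spectral_curve_def)

text \<open>Conjugation is continuous and fixes \<open>a\<close>. The punctured version also uses
  that no other nearby point is sent to \<open>a\<close>, so that composing with conjugation creates
  no further singularities.\<close>

lemma conjugate_preserves_nbhds:
  assumes a: "a \<in> branch_points S" and V: "conj_nbhd S a V" and N: "open N" "a \<in> N"
  obtains N' where "open N'" "a \<in> N'" "N' \<subseteq> N \<inter> V" "\<And>q. q \<in> N' - {a} \<Longrightarrow> conjugate S q \<in> N - {a}"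
proof
  define N' where "N' = V \<inter> conjugate S -` N \<inter> N"
  have oV: "open V" and aV: "a \<in> V" and fix_a: "conjugate S a = a"
    and con: "continuous_on V (conjugate S)"
    using V by (auto simp: conj_nbhd_def surface_holomorphic_map_def)
  have "open (V \<inter> conjugate S -` N)"
    using continuous_open_preimage[OF con oV N(1)] .
  then show "open N'" using N by (auto simp: N'_def)
  show "a \<in> N'" "N' \<subseteq> N \<inter> V" using fix_a N aV by (auto simp: N'_def)
  fix q assume q: "q \<in> N' - {a}"
  have fibre: "{r \<in> V. xfun S r = xfun S u} = {u, conjugate S u}" if "u \<in> V" for u
    using V that by (auto simp: conj_nbhd_def)
  \<comment> \<open>A point sent to \<open>a\<close> would have the same value of
    \<open>xfun S\<close> as \<open>a\<close>, but the fibre through \<open>a\<close> is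
    \<open>{a, conjugate S a}\<close>, which is \<open>{a}\<close>.\<close>
  have "conjugate S q \<noteq> a"
  proof
    assume "conjugate S q = a"
    then have "xfun S a = xfun S q" using fibre[of q] q by (auto simp: N'_def)
    then have "q \<in> {a, conjugate S a}" using fibre[OF aV] q by (auto simp: N'_def)
    then show False using fix_a q by simp
  qed
  then show "conjugate S q \<in> N - {a}" using q by (simp add: N'_def)
qed

text \<open>In a coordinate, conjugation is holomorphic and fixes the branch point, and composition
  with it keeps the singularity isolated. This serves the factor of the integrand evaluated at the
  conjugate point.\<close>

lemma isolated_at_branch_points_conjugate:
  assumes f: "isolated_at_branch_points S f"
  shows "isolated_at_branch_points S (\<lambda>q. f (conjugate S q))"
  unfolding isolated_at_branch_points_def
proof safe
  fix a c assume a: "a \<in> branch_points S" and c: "c \<in> atlas S" "a \<in> fst c"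
  obtain V where V: "conj_nbhd S a V" using conj_nbhd_at[OF a] by blast
  have "open (fst c)" using riemann_surface_atlas c by (auto simp: riemann_surface_def)
  from conjugate_preserves_nbhds[OF a V this c(2)] obtain N where
    N: "open N" "a \<in> N" "N \<subseteq> fst c \<inter> V" "\<And>q. q \<in> N - {a} \<Longrightarrow> conjugate S q \<in> fst c - {a}"
    by blast
  define g where "g = snd c \<circ> conjugate S \<circ> chart_inv c"
  have fix_a: "conjugate S a = a" using V by (auto simp: conj_nbhd_def)
  have "g holomorphic_on (snd c ` {q \<in> fst c \<inter> V. conjugate S q \<in> fst c})"
    using V c by (auto simp: conj_nbhd_def surface_holomorphic_map_def g_def)
  then have "g holomorphic_on snd c ` (fst c \<inter> N)"
  proof (rule holomorphic_on_subset, safe)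
    fix q assume "q \<in> fst c" "q \<in> N"
    then have "q \<in> {q \<in> fst c \<inter> V. conjugate S q \<in> fst c}"
      using N(3) N(4)[of q] fix_a c(2) by (cases "q = a") auto
    then show "snd c q \<in> snd c ` {q \<in> fst c \<inter> V. conjugate S q \<in> fst c}" by (rule imageI)
  qed
  then have "g analytic_on {snd c a}"
    using open_chart_image[OF riemann_surface_atlas c(1) N(1)] N(2) c(2) unfolding analytic_at by blast
  moreover have "g (snd c a) = snd c a"
    using chart_inv_left[OF riemann_surface_atlas c] fix_a by (simp add: g_def)
  ultimately have "isolated_singularity_at (\<lambda>z. (f \<circ> chart_inv c) (g z)) (snd c a)"
    using f a c
    by (intro isolated_singularity_at_compose[where f = "f \<circ> chart_inv c" and g = g])
      (simp_all add: isolated_at_branch_points_def)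
  \<comment> \<open>Near \<open>a\<close> the conjugate point stays in the chart, so passing to the
    coordinate and back cancels.\<close>
  moreover have "\<forall>\<^sub>F z in at (snd c a). (f \<circ> chart_inv c) (g z) = ((\<lambda>q. f (conjugate S q)) \<circ> chart_inv c) z"
    using eventually_chart_inv[OF riemann_surface_atlas c(1) N(1,2) c(2)]
  proof eventually_elim
    case (elim z)
    then have "conjugate S (chart_inv c z) \<in> fst c" using N(4) by blast
    then show ?case using chart_inv_left[OF riemann_surface_atlas c(1)] by (simp add: g_def)
  qed
  ultimately show "isolated_singularity_at ((\<lambda>q. f (conjugate S q)) \<circ> chart_inv c) (snd c a)"
    by (rule iffD1[OF isolated_singularity_at_cong[OF _ refl], rotated])
qed

lemma isolated_at_branch_points_mult:
  "isolated_at_branch_points S f \<Longrightarrow> isolated_at_branch_points S g \<Longrightarrow>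
    isolated_at_branch_points S (\<lambda>q. f q * g q)"
  by (simp add: isolated_at_branch_points_def o_def isolated_singularity_at_times)

text \<open>Near \<open>a\<close> there is no other branch point, so \<open>a\<close> is the only
  possible singularity there.\<close>

lemma isolated_at_branch_points_holomorphic:
  assumes "surface_holomorphic (atlas S) (- branch_points S) f"
  shows "isolated_at_branch_points S f"
  unfolding isolated_at_branch_points_def
proof safe
  fix a c assume a: "a \<in> branch_points S" and c: "c \<in> atlas S" "a \<in> fst c"
  let ?U = "snd c ` (fst c \<inter> - (branch_points S - {a}))"
  show "isolated_singularity_at (f \<circ> chart_inv c) (snd c a)"
  proof (rule isolated_singularity_at_holomorphic)
    show "(f \<circ> chart_inv c) holomorphic_on ?U - {snd c a}"
      by (rule surface_holomorphicD[OF assms c(1)]) auto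
    show "open ?U" by (rule open_chart_image[OF riemann_surface_atlas c(1) open_minus_branch_points])
  qed (use c in auto)
qed

lemma isolated_at_branch_points_cyl:
  assumes "b \<notin> branch_points S"
  shows "isolated_at_branch_points S (\<lambda>q. cyl S q b)"
  unfolding isolated_at_branch_points_def
proof safe
  fix a c assume a: "a \<in> branch_points S" and c: "c \<in> atlas S" "a \<in> fst c"
  have "((\<lambda>q. cyl S q b) \<circ> chart_inv c) meromorphic_on snd c ` fst c"
    using S assms c by (auto simp: spectral_curve_def surface_meromorphic_def)
  then have "((\<lambda>q. cyl S q b) \<circ> chart_inv c) meromorphic_on {snd c a}"
    by (rule meromorphic_on_subset) (use c in auto)
  then show "isolated_singularity_at ((\<lambda>q. cyl S q b) \<circ> chart_inv c) (snd c a)"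
    by (simp add: meromorphic_at_iff)
qed

lemma isolated_singularity_deriv_xfun:
  assumes c: "c \<in> atlas S" "a \<in> fst c"
  shows "isolated_singularity_at (deriv (xfun S \<circ> chart_inv c)) (snd c a)"
proof -
  have "(xfun S \<circ> chart_inv c) meromorphic_on snd c ` fst c"
    using S c by (auto simp: spectral_curve_def surface_nicely_meromorphic_def nicely_meromorphic_on_def)
  then have "(xfun S \<circ> chart_inv c) meromorphic_on {snd c a}"
    by (rule meromorphic_on_subset) (use c in auto)
  then show ?thesis
    by (intro isolated_singularity_at_deriv) (simp add: meromorphic_at_iff)
qed

text \<open>Separate \<open>p\<close> from \<open>a\<close> by disjoint open sets and shrink around
  \<open>a\<close> until conjugation stays on its side. Then neither \<open>q\<close> nor its
  conjugate meets the neighbourhood of \<open>p\<close>, and a whole product lies in the domain of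
  regularity.\<close>

lemma kernel_regular_near_point:
  assumes a: "a \<in> branch_points S" and p: "p \<notin> branch_points S"
  obtains P N where "open P" "p \<in> P" "open N" "a \<in> N"
    "continuous_on (P \<times> (N - {a})) (\<lambda>(p, q). rec_kernel S p q (conjugate S q))"
    "\<And>q. q \<in> N - {a} \<Longrightarrow> surface_holomorphic (atlas S) P (\<lambda>p. rec_kernel S p q (conjugate S q))"
    "\<And>p. p \<in> P \<Longrightarrow> surface_holomorphic (atlas S) (N - {a}) (\<lambda>q. rec_kernel S p q (conjugate S q))"
proof -
  obtain V where V: "conj_nbhd S a V" and reg: "kernel_regular S a V" using conj_nbhd_at[OF a] by blast
  define D where "D = {(p, q). p \<notin> branch_points S \<and> q \<in> V - {a} \<and> p \<noteq> q \<and> p \<noteq> conjugate S q}"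
  let ?k = "\<lambda>p q. rec_kernel S p q (conjugate S q)"
  have cont: "continuous_on D (\<lambda>(p, q). ?k p q)"
    and hol1: "\<And>q. surface_holomorphic (atlas S) {p. (p, q) \<in> D} (\<lambda>p. ?k p q)"
    and hol2: "\<And>p. surface_holomorphic (atlas S) {q. (p, q) \<in> D} (\<lambda>q. ?k p q)"
    using reg by (simp_all add: kernel_regular_def D_def)
  have "p \<noteq> a" using a p by auto
  then obtain P0 N0 where PN: "open P0" "p \<in> P0" "open N0" "a \<in> N0" "P0 \<inter> N0 = {}"
    using hausdorff by metis
  obtain N where N: "open N" "a \<in> N" "N \<subseteq> N0 \<inter> V" "\<And>q. q \<in> N - {a} \<Longrightarrow> conjugate S q \<in> N0 - {a}"
    using conjugate_preserves_nbhds[OF a V PN(3,4)] by blast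
  define P where "P = P0 - branch_points S"
  have PND: "P \<times> (N - {a}) \<subseteq> D"
    using N(3,4) PN(5) by (force simp: P_def D_def)
  show thesis
  proof
    show "open P" using PN(1) finite_branch_points by (simp add: P_def finite_imp_closed open_Diff)
    show "p \<in> P" using p PN(2) by (simp add: P_def)
    show "continuous_on (P \<times> (N - {a})) (\<lambda>(p, q). ?k p q)" using cont PND by (rule continuous_on_subset)
    show "surface_holomorphic (atlas S) P (\<lambda>p. ?k p q)" if "q \<in> N - {a}" for q
      by (rule surface_holomorphic_subset[OF hol1]) (use PND that in blast)
    show "surface_holomorphic (atlas S) (N - {a}) (\<lambda>q. ?k p q)" if "p \<in> P" for p
      by (rule surface_holomorphic_subset[OF hol2]) (use PND that in blast)
  qed (use N in auto)
qed

lemma isolated_at_branch_points_kernel: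
  assumes p: "p \<notin> branch_points S"
  shows "isolated_at_branch_points S (\<lambda>q. rec_kernel S p q (conjugate S q))"
  unfolding isolated_at_branch_points_def
proof safe
  fix a c assume a: "a \<in> branch_points S" and c: "c \<in> atlas S" "a \<in> fst c"
  let ?k = "\<lambda>q. rec_kernel S p q (conjugate S q)"
  obtain P N where N: "p \<in> P" "open N" "a \<in> N"
    and hol: "\<And>p. p \<in> P \<Longrightarrow> surface_holomorphic (atlas S) (N - {a}) (\<lambda>q. rec_kernel S p q (conjugate S q))"
    by (rule kernel_regular_near_point[OF a p]) (rule that; assumption)
  show "isolated_singularity_at (?k \<circ> chart_inv c) (snd c a)"
  proof (rule isolated_singularity_at_holomorphic)
    show "(?k \<circ> chart_inv c) holomorphic_on snd c ` (fst c \<inter> N) - {snd c a}"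
      by (rule surface_holomorphicD[OF hol[OF N(1)] c(1)]) auto
    show "open (snd c ` (fst c \<inter> N))" by (rule open_chart_image[OF riemann_surface_atlas c(1) N(2)])
  qed (use N c in auto)
qed

section \<open>Linearity and locality of the residue operator\<close>

lemma residue_chart: "residue_chart S a \<in> atlas S" "a \<in> fst (residue_chart S a)"
proof -
  obtain c where "c \<in> atlas S \<and> a \<in> fst c" using chart_at by blast
  then have "residue_chart S a \<in> atlas S \<and> a \<in> fst (residue_chart S a)"
    unfolding residue_chart_def by (rule someI)
  then show "residue_chart S a \<in> atlas S" "a \<in> fst (residue_chart S a)" by auto
qed

text \<open>The kernel, each \<open>F i\<close> and the derivative of \<open>xfun S\<close> in the
  chart have isolated singularities at the branch points, hence so do their products, and residues
  add.\<close>

lemma kernel_op_sum: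
  assumes p: "p \<notin> branch_points S"
    and "\<And>i. i \<in> I \<Longrightarrow> isolated_at_branch_points S (\<lambda>q. F i q (conjugate S q))"
  shows "kernel_op S p (\<lambda>q q'. \<Sum>i\<in>I. F i q q') = (\<Sum>i\<in>I. kernel_op S p (F i))"
proof -
  have "residue_dx S (\<lambda>q. rec_kernel S p q (conjugate S q) * (\<Sum>i\<in>I. F i q (conjugate S q))) a =
      (\<Sum>i\<in>I. residue_dx S (\<lambda>q. rec_kernel S p q (conjugate S q) * F i q (conjugate S q)) a)"
    if a: "a \<in> branch_points S" for a
    unfolding residue_dx_def Let_def sum_distrib_left sum_distrib_right
  proof (rule residue_sum_isolated, fold residue_chart_def)
    fix i assume i: "i \<in> I"
    let ?f = "\<lambda>q. rec_kernel S p q (conjugate S q) * F i q (conjugate S q)"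
    have "isolated_singularity_at (?f \<circ> chart_inv (residue_chart S a)) (snd (residue_chart S a) a)"
      using isolated_at_branch_points_mult[OF isolated_at_branch_points_kernel[OF p] assms(2)[OF i]]
        a residue_chart[of a]
      by (auto simp: isolated_at_branch_points_def)
    then show "isolated_singularity_at (\<lambda>z. ?f (chart_inv (residue_chart S a) z) *
        deriv (xfun S \<circ> chart_inv (residue_chart S a)) z) (snd (residue_chart S a) a)"
      using isolated_singularity_deriv_xfun[OF residue_chart]
      by (auto simp: o_def intro: isolated_singularity_at_times)
  qed
  then show ?thesis
    unfolding kernel_op_def by (subst sum.swap) simp
qed

text \<open>A residue sees only a punctured neighbourhood of \<open>a\<close>, and there both
  \<open>q\<close> and its conjugate avoid all branch points.\<close>

lemma kernel_op_cong:
  assumes "\<And>q q'. q \<notin> branch_points S \<Longrightarrow> q' \<notin> branch_points S \<Longrightarrow> F q q' = G q q'"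
  shows "kernel_op S p F = kernel_op S p G"
  unfolding kernel_op_def residue_dx_def Let_def
proof (intro sum.cong refl residue_cong, fold residue_chart_def)
  fix a assume a: "a \<in> branch_points S"
  obtain V where V: "conj_nbhd S a V" using conj_nbhd_at[OF a] by blast
  obtain N where N: "open N" "a \<in> N" "N \<subseteq> - (branch_points S - {a}) \<inter> V"
    "\<And>q. q \<in> N - {a} \<Longrightarrow> conjugate S q \<in> - (branch_points S - {a}) - {a}"
    using conjugate_preserves_nbhds[OF a V open_minus_branch_points] by blast
  show "\<forall>\<^sub>F z in at (snd (residue_chart S a) a).
     rec_kernel S p (chart_inv (residue_chart S a) z) (conjugate S (chart_inv (residue_chart S a) z)) *
     F (chart_inv (residue_chart S a) z) (conjugate S (chart_inv (residue_chart S a) z)) *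
     deriv (xfun S \<circ> chart_inv (residue_chart S a)) z =
     rec_kernel S p (chart_inv (residue_chart S a) z) (conjugate S (chart_inv (residue_chart S a) z)) *
     G (chart_inv (residue_chart S a) z) (conjugate S (chart_inv (residue_chart S a) z)) *
     deriv (xfun S \<circ> chart_inv (residue_chart S a)) z"
    using eventually_chart_inv[OF riemann_surface_atlas residue_chart(1) N(1,2) residue_chart(2)]
  proof eventually_elim
    case (elim z)
    then have "chart_inv (residue_chart S a) z \<in> N - {a}" by blast
    then have "chart_inv (residue_chart S a) z \<notin> branch_points S"
      "conjugate S (chart_inv (residue_chart S a) z) \<notin> branch_points S"
      using N(3,4) by blast+
    then show ?case using assms by simp
  qed
qed

section \<open>Holomorphic dependence on the outer variable\<close>

text \<open>Near \<open>p\<close> the residue is an integral over one fixed circle around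
  \<open>a\<close>, on which the kernel is holomorphic in the outer variable. The result is local
  because the circle must avoid the singularities where the outer variable equals \<open>q\<close>
  or its conjugate.\<close>

lemma holomorphic_on_kernel_residue:
  assumes a: "a \<in> branch_points S" and p: "p \<notin> branch_points S" "p \<in> fst d" and d: "d \<in> atlas S"
    and c: "c \<in> atlas S" "a \<in> fst c" and h: "isolated_singularity_at h (snd c a)"
  obtains U where "open U" "snd d p \<in> U"
    "(\<lambda>w. residue (\<lambda>z. rec_kernel S (chart_inv d w) (chart_inv c z) (conjugate S (chart_inv c z)) * h z)
        (snd c a)) holomorphic_on U"
proof -
  let ?k = "\<lambda>p q. rec_kernel S p q (conjugate S q)"
  obtain P N where P: "open P" "p \<in> P" and N: "open N" "a \<in> N"
    and cont: "continuous_on (P \<times> (N - {a})) (\<lambda>(p, q). ?k p q)"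
    and hol1: "\<And>q. q \<in> N - {a} \<Longrightarrow> surface_holomorphic (atlas S) P (\<lambda>p. ?k p q)"
    and hol2: "\<And>p. p \<in> P \<Longrightarrow> surface_holomorphic (atlas S) (N - {a}) (\<lambda>q. ?k p q)"
    by (rule kernel_regular_near_point[OF a p(1)]) (rule that; assumption)
  define U where "U = snd d ` (fst d \<inter> P)"
  define z0 where "z0 = snd c a"
  define K where "K = (\<lambda>w z. ?k (chart_inv d w) (chart_inv c z) * h z)"
  obtain r0 where r0: "r0 > 0" "h analytic_on ball z0 r0 - {z0}"
    using h by (auto simp: isolated_singularity_at_def z0_def)
  have "open (snd c ` (fst c \<inter> N))" by (rule open_chart_image[OF riemann_surface_atlas c(1) N(1)])
  moreover have "z0 \<in> snd c ` (fst c \<inter> N)" using c N by (simp add: z0_def)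
  ultimately obtain r1 where r1: "r1 > 0" "ball z0 r1 \<subseteq> snd c ` (fst c \<inter> N)"
    using openE by blast
  \<comment> \<open>Within this radius both \<open>h\<close> and the kernel are regular away from
    \<open>z0\<close>.\<close>
  define r where "r = min r0 r1"
  define B where "B = ball z0 r - {z0}"
  have r: "r > 0" using r0 r1 by (simp add: r_def)
  have hB: "h holomorphic_on B"
    using r0(2) by (intro analytic_imp_holomorphic) (auto simp: B_def r_def elim!: analytic_on_subset)
  have Bim: "B \<subseteq> snd c ` (fst c \<inter> N)" using r1(2) by (auto simp: B_def r_def)
  have BN: "chart_inv c z \<in> N - {a}" "z \<in> snd c ` (fst c \<inter> (N - {a}))" if "z \<in> B" for z
  proof -
    obtain q where q: "q \<in> fst c" "q \<in> N" "z = snd c q" using Bim \<open>z \<in> B\<close> by auto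
    moreover have "q \<noteq> a" using \<open>z \<in> B\<close> q by (auto simp: B_def z0_def)
    ultimately show "chart_inv c z \<in> N - {a}" "z \<in> snd c ` (fst c \<inter> (N - {a}))"
      using chart_inv_left[OF riemann_surface_atlas c(1)] by auto
  qed
  have UP: "chart_inv d w \<in> P" if "w \<in> U" for w
    using that chart_inv_left[OF riemann_surface_atlas d] by (auto simp: U_def)
  have "continuous_on (U \<times> B) (\<lambda>x. (chart_inv d (fst x), chart_inv c (snd x)))"
    by (intro continuous_on_Pair continuous_on_compose2[OF continuous_on_chart_inv[OF riemann_surface_atlas d]]
        continuous_on_compose2[OF continuous_on_chart_inv[OF riemann_surface_atlas c(1)]]
        continuous_on_fst continuous_on_snd continuous_on_id)
      (use Bim in \<open>auto simp: U_def\<close>)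
  then have "continuous_on (U \<times> B) (\<lambda>x. (\<lambda>(p, q). ?k p q) (chart_inv d (fst x), chart_inv c (snd x)))"
    by (rule continuous_on_compose2[OF cont], intro image_subsetI)
      (use UP BN(1) in \<open>simp add: mem_Times_iff\<close>)
  moreover have "continuous_on (U \<times> B) (\<lambda>x. h (snd x))"
    by (rule continuous_on_compose2[OF holomorphic_on_imp_continuous_on[OF hB]])
      (auto intro: continuous_on_snd continuous_on_id)
  ultimately have K_cont: "continuous_on (U \<times> B) (\<lambda>(w, z). K w z)"
    by (auto simp: K_def case_prod_unfold intro: continuous_on_mult)
  have K_hol1: "(\<lambda>w. K w z) holomorphic_on U" if "z \<in> B" for z
    using surface_holomorphicD[OF hol1[OF BN(1)[OF that]] d, of U]
    by (auto simp: K_def U_def o_def intro: holomorphic_on_mult)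
  have K_hol2: "K w holomorphic_on ball z0 r - {z0}" if "w \<in> U" for w
  proof -
    have "(?k (chart_inv d w) \<circ> chart_inv c) holomorphic_on B"
      by (rule surface_holomorphicD[OF hol2[OF UP[OF that]] c(1)]) (use BN(2) in blast)
    then have "(\<lambda>z. ?k (chart_inv d w) (chart_inv c z) * h z) holomorphic_on B"
      using hB by (auto simp: o_def intro: holomorphic_on_mult)
    then show ?thesis by (simp add: K_def B_def)
  qed
  \<comment> \<open>Half the radius keeps the circle inside the punctured disc \<open>B\<close>; the
    same circle works for every \<open>w\<close> in \<open>U\<close>.\<close>
  let ?g = "circlepath z0 (r / 2)"
  have pB: "path_image ?g \<subseteq> B" using r by (auto simp: B_def dist_norm norm_minus_commute)
  have oU: "open U" unfolding U_def by (rule open_chart_image[OF riemann_surface_atlas d P(1)])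
  have "(\<lambda>w. contour_integral ?g (K w)) holomorphic_on U"
  proof (rule holomorphic_on_contour_integral_param[OF oU])
    show "continuous_on {0..1} (\<lambda>t. vector_derivative ?g (at t))"
      by (simp add: vector_derivative_circlepath) (intro continuous_intros)
    show "continuous_on (U \<times> path_image ?g) (\<lambda>(w, z). K w z)"
      by (rule continuous_on_subset[OF K_cont]) (use pB in auto)
  qed (use pB K_hol1 in auto)
  then have "(\<lambda>w. contour_integral ?g (K w) / (2 * pi * \<i>)) holomorphic_on U"
    by (intro holomorphic_intros) auto
  moreover have "contour_integral ?g (K w) / (2 * pi * \<i>) = residue (K w) z0" if "w \<in> U" for w
  proof -
    have "(K w has_contour_integral 2 * pi * \<i> * residue (K w) z0) ?g"
      by (rule base_residue[OF _ _ _ K_hol2[OF that]]) (use r in auto)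
    then show ?thesis by (simp add: contour_integral_unique)
  qed
  ultimately have "(\<lambda>w. residue (K w) z0) holomorphic_on U"
    using holomorphic_transform by fastforce
  then show thesis
    using that[OF oU] p P by (auto simp: U_def K_def z0_def)
qed

lemma surface_holomorphic_kernel_op:
  assumes F: "isolated_at_branch_points S (\<lambda>q. F q (conjugate S q))"
  shows "surface_holomorphic (atlas S) (- branch_points S) (\<lambda>p. kernel_op S p F)"
  unfolding surface_holomorphic_def
proof
  fix d assume d: "d \<in> atlas S"
  define R where "R = (\<lambda>a w. residue_dx S
    (\<lambda>q. rec_kernel S (chart_inv d w) q (conjugate S q) * F q (conjugate S q)) a)"
  have "(\<lambda>w. \<Sum>a\<in>branch_points S. R a w) holomorphic_on snd d ` (fst d \<inter> - branch_points S)"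
  proof (intro holomorphic_on_sum)
    fix a assume a: "a \<in> branch_points S"
    let ?c = "residue_chart S a"
    \<comment> \<open>Collects the factors of the integrand that do not depend on the outer
      variable.\<close>
    define h where "h = (\<lambda>z. F (chart_inv ?c z) (conjugate S (chart_inv ?c z)) *
      deriv (xfun S \<circ> chart_inv ?c) z)"
    have "isolated_singularity_at h (snd ?c a)"
      using F a residue_chart[of a] isolated_singularity_deriv_xfun[OF residue_chart]
      by (auto simp: h_def isolated_at_branch_points_def o_def intro!: isolated_singularity_at_times)
    note local = holomorphic_on_kernel_residue[OF a _ _ d residue_chart this]
    have R: "R a = (\<lambda>w. residue (\<lambda>z. rec_kernel S (chart_inv d w) (chart_inv ?c z)
        (conjugate S (chart_inv ?c z)) * h z) (snd ?c a))"
      by (simp add: R_def residue_dx_def h_def mult.assoc Let_def flip: residue_chart_def)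
    \<comment> \<open>The neighbourhood \<open>U\<close> varies with the point, so the local results
      are glued through analyticity at each point.\<close>
    have "R a analytic_on snd d ` (fst d \<inter> - branch_points S)"
    proof (subst analytic_on_analytic_at, safe)
      fix p assume p: "p \<in> fst d" "p \<notin> branch_points S"
      obtain U where "open U" "snd d p \<in> U" "R a holomorphic_on U"
        unfolding R by (rule local[OF p(2,1)])
      then show "R a analytic_on {snd d p}" unfolding analytic_at by blast
    qed
    then show "R a holomorphic_on snd d ` (fst d \<inter> - branch_points S)"
      by (rule analytic_imp_holomorphic)
  qed
  then show "(\<lambda>p. kernel_op S p F) \<circ> chart_inv d holomorphic_on snd d ` (fst d \<inter> - branch_points S)"
    by (simp add: kernel_op_def o_def R_def)
qed

section \<open>Expansion of the recursion over labeled trees\<close>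

text \<open>A leaf is a cylinder, meromorphic in the root variable. At a vertex, isolated
  singularities of the two subtrees make the evaluation holomorphic off the branch points, so its
  own singularities there are isolated again.\<close>

lemma isolated_at_branch_points_ev:
  assumes "length ls = tree_order t + 1" "set ls \<inter> branch_points S = {}"
  shows "isolated_at_branch_points S (ev S t ls)"
  using assms
proof (induction t arbitrary: ls)
  case Edge
  then have "hd ls \<notin> branch_points S" by (cases ls) auto
  from isolated_at_branch_points_cyl[OF this] show ?case by simp
next
  case (Graft t1 t2)
  let ?ls1 = "take (tree_order t1 + 1) ls" and ?ls2 = "drop (tree_order t1 + 1) ls"
  have "isolated_at_branch_points S (ev S t1 ?ls1)"
    using Graft.prems by (intro Graft.IH) (auto dest: in_set_takeD)
  moreover have "isolated_at_branch_points S (ev S t2 ?ls2)"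
    using Graft.prems by (intro Graft.IH) (auto dest: in_set_dropD)
  ultimately have "isolated_at_branch_points S (\<lambda>q. ev S t1 ?ls1 q * ev S t2 ?ls2 (conjugate S q))"
    by (intro isolated_at_branch_points_mult isolated_at_branch_points_conjugate)
  then have "surface_holomorphic (atlas S) (- branch_points S)
      (\<lambda>p. kernel_op S p (\<lambda>q q'. ev S t1 ?ls1 q * ev S t2 ?ls2 q'))"
    by (rule surface_holomorphic_kernel_op)
  then show ?case by (intro isolated_at_branch_points_holomorphic) simp
qed

text \<open>A list \<open>is\<close> of indices is used because the variables \<open>map f is\<close> may coincide.\<close>

lemma W0_eq_sum_ev:
  assumes "distinct is" "is \<noteq> []" "f ` set is \<inter> branch_points S = {}" "p \<notin> branch_points S"
  shows "W0 S p (map f is) =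
    (\<Sum>(xs, t)\<in>permutations_of_set (set is) \<times> trees (length is - 1). ev S t (map f xs) p)"
  using assms
proof (induction "length is" arbitrary: "is" p rule: less_induct)
  case less
  show ?case
  proof (cases "length is \<ge> 2")
    case False
    then obtain i where "is = [i]" using less.prems(2) by (cases "is" rule: remdups_adj.cases) auto
    then show ?thesis by (simp add: trees_0)
  next
    case True
    define Part where "Part = {(L, M). L \<union> M = {..<length is} \<and> L \<inter> M = {} \<and> L \<noteq> {} \<and> M \<noteq> {}}"
    define Lab where "Lab L = permutations_of_set (set (nths is L)) \<times> trees (length (nths is L) - 1)" for L
    \<comment> \<open>Indexes the expanded product: an ordered decomposition together with a labeled
      tree on each block.\<close>
    define I where "I = (SIGMA (L, M):Part. Lab L \<times> Lab M)"
    define F where "F = (\<lambda>((L :: nat set, M :: nat set), (xs, s), (ys, t)) q q'.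
      ev S s (map f xs) q * ev S t (map f ys) q')"
    have finPart: "finite Part"
      by (rule finite_subset[of _ "Pow {..<length is} \<times> Pow {..<length is}"]) (auto simp: Part_def)
    have finLab: "finite (Lab L)" for L
      by (simp add: Lab_def finite_trees)
    \<comment> \<open>The nonempty complement \<open>M\<close> makes \<open>L\<close> a proper
      subset, so the induction hypothesis applies; exchanging the two gives the other
      factor.\<close>
    have IH: "W0 S q (nths (map f is) L) = (\<Sum>(xs, t)\<in>Lab L. ev S t (map f xs) q)"
      if LM: "L \<union> M = {..<length is}" "L \<inter> M = {}" "L \<noteq> {}" "M \<noteq> {}" and q: "q \<notin> branch_points S" for L M q
    proof -
      have L: "{i. i < length is \<and> i \<in> L} = L" using LM by auto
      have "L \<subset> {..<length is}" using LM by auto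
      then have "card L < card {..<length is}" by (intro psubset_card_mono) auto
      moreover have len: "length (nths is L) = card L" unfolding length_nths L ..
      ultimately have "length (nths is L) < length is" by simp
      moreover have "finite L" using \<open>L \<subset> {..<length is}\<close> by (auto intro: finite_subset)
      then have "nths is L \<noteq> []" using len LM(3) by (metis card_eq_0_iff list.size(3))
      moreover have "f ` set (nths is L) \<inter> branch_points S = {}"
        using less.prems(3) set_nths_subset[of "is" L] by blast
      ultimately have "W0 S q (map f (nths is L)) = (\<Sum>(xs, t)\<in>Lab L. ev S t (map f xs) q)"
        unfolding Lab_def using less.prems(1) q by (intro less.hyps) auto
      then show ?thesis by (simp add: nths_map)
    qed
    obtain a b ps where abps: "map f is = a # b # ps"
      using True by (cases "is" rule: remdups_adj.cases) auto
    have "W0 S p (map f is) = kernel_op S p (\<lambda>q q'. \<Sum>(L, M)\<in>Part.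
        W0 S q (nths (map f is) L) * W0 S q' (nths (map f is) M))"
      unfolding Part_def length_map[of f "is", symmetric] abps by (rule W0.simps(3))
    \<comment> \<open>The induction hypothesis holds only off the branch points, which is enough
      under the residues.\<close>
    also have "\<dots> = kernel_op S p (\<lambda>q q'. \<Sum>i\<in>I. F i q q')"
    proof (rule kernel_op_cong)
      fix q q' assume q: "q \<notin> branch_points S" "q' \<notin> branch_points S"
      have "(\<Sum>(L, M)\<in>Part. W0 S q (nths (map f is) L) * W0 S q' (nths (map f is) M)) =
          (\<Sum>LM\<in>Part. \<Sum>w\<in>Lab (fst LM) \<times> Lab (snd LM). F (LM, w) q q')"
      proof (rule sum.cong[OF refl], clarify)
        fix L M assume LM: "(L, M) \<in> Part"
        have "W0 S q (nths (map f is) L) = (\<Sum>(xs, t)\<in>Lab L. ev S t (map f xs) q)"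
          by (rule IH[of L M]) (use LM q in \<open>auto simp: Part_def\<close>)
        moreover have "W0 S q' (nths (map f is) M) = (\<Sum>(xs, t)\<in>Lab M. ev S t (map f xs) q')"
          by (rule IH[of M L]) (use LM q in \<open>auto simp: Part_def\<close>)
        ultimately show "W0 S q (nths (map f is) L) * W0 S q' (nths (map f is) M) =
            (\<Sum>w\<in>Lab (fst (L, M)) \<times> Lab (snd (L, M)). F ((L, M), w) q q')"
          by (simp add: sum_product sum.cartesian_product F_def case_prod_unfold)
      qed
      also have "\<dots> = (\<Sum>i\<in>I. F i q q')"
        unfolding I_def by (subst sum.Sigma) (auto simp: finPart finLab case_prod_unfold)
      finally show "(\<Sum>(L, M)\<in>Part. W0 S q (nths (map f is) L) * W0 S q' (nths (map f is) M)) =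
          (\<Sum>i\<in>I. F i q q')" .
    qed
    also have "\<dots> = (\<Sum>i\<in>I. kernel_op S p (F i))"
    proof (rule kernel_op_sum[OF less.prems(4)])
      fix i assume "i \<in> I"
      then obtain L M xs s ys t where i: "i = ((L, M), (xs, s), (ys, t))" and LM: "(L, M) \<in> Part"
        and xs: "(xs, s) \<in> Lab L" and ys: "(ys, t) \<in> Lab M"
        by (auto simp: I_def)
      have iso: "isolated_at_branch_points S (ev S s (map f xs))"
        if xs: "(xs, s) \<in> Lab L" and L: "L \<subseteq> {..<length is}" "L \<noteq> {}" for xs s L
      proof (rule isolated_at_branch_points_ev)
        have "set (nths is L) \<noteq> {}" using L by (auto simp: set_nths)
        then have "length (nths is L) \<noteq> 0" by auto
        moreover have set: "set xs = set (nths is L)" "distinct xs"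
          using xs by (auto simp: Lab_def dest: permutations_of_setD)
        moreover have "length xs = length (nths is L)"
          using set less.prems(1) distinct_card[of xs] distinct_card[of "nths is L"] by simp
        ultimately show "length (map f xs) = tree_order s + 1"
          using xs by (auto simp: Lab_def in_trees)
        show "set (map f xs) \<inter> branch_points S = {}"
          using set less.prems(3) set_nths_subset[of "is" L] by auto
      qed
      have "isolated_at_branch_points S (ev S s (map f xs))" "isolated_at_branch_points S (ev S t (map f ys))"
        using LM by (auto intro!: iso[OF xs] iso[OF ys] simp: Part_def)
      then show "isolated_at_branch_points S (\<lambda>q. F i q (conjugate S q))"
        unfolding i F_def prod.case
        by (intro isolated_at_branch_points_mult isolated_at_branch_points_conjugate)
    qed
    also have "\<dots> = (\<Sum>((L, M), (xs, s), (ys, t))\<in>I.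
        kernel_op S p (\<lambda>q q'. ev S s (map f xs) q * ev S t (map f ys) q'))"
      by (rule sum.cong) (auto simp: F_def)
    also have "\<dots> = (\<Sum>(zs, u)\<in>permutations_of_set (set is) \<times> trees (length is - 1). case u of Graft s t \<Rightarrow>
        kernel_op S p (\<lambda>q q'. ev S s (map f (take (tree_order s + 1) zs)) q *
          ev S t (map f (drop (tree_order s + 1) zs)) q'))"
      unfolding I_def Lab_def Part_def by (rule sum_partitions_eq_sum_trees[OF less.prems(1) True])
    \<comment> \<open>At least two labels rule out \<open>Edge\<close>, so each summand is the
      vertex equation of \<open>ev\<close> read backwards.\<close>
    also have "\<dots> = (\<Sum>(zs, u)\<in>permutations_of_set (set is) \<times> trees (length is - 1). ev S u (map f zs) p)"
      using True
      by (intro sum.cong refl) (auto simp: in_trees take_map drop_map split: pbtree.splits)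
    finally show ?thesis .
  qed
qed

end

theorem theorem1:
  fixes S :: "'a::t2_space spectral_data"
    and n :: nat and p :: 'a and ps :: "'a list"
  assumes "spectral_curve S"
    and "n \<ge> 1"
    and "length ps = n + 1"
    and "p \<notin> branch_points S"
    and "set ps \<inter> branch_points S = {}"
  shows "let c = Poly_Mapping.lookup (lr_power one_vertex n)
         in lr_power one_vertex n = (\<Sum>t\<in>trees n. Poly_Mapping.single t (c t)) \<and>
            W0 S p ps =
              (\<Sum>\<sigma> | \<sigma> permutes {..<n + 1}.
                 \<Sum>t\<in>trees n. of_rat (c t) * ev S t (permute_list \<sigma> ps) p)"
proof -
  let ?c = "Poly_Mapping.lookup (lr_power one_vertex n)"
  have c: "?c t = 1" if "t \<in> trees n" for t
    using that by (simp add: lookup_lr_power_one_vertex in_trees)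
  have "lr_power one_vertex n = (\<Sum>t\<in>trees n. Poly_Mapping.single t (?c t))"
    by (subst lr_power_one_vertex_eq_sum) (simp add: c)
  moreover have "W0 S p ps =
      (\<Sum>\<sigma> | \<sigma> permutes {..<n + 1}. \<Sum>t\<in>trees n. of_rat (?c t) * ev S t (permute_list \<sigma> ps) p)"
  proof -
    have ps: "map ((!) ps) [0..<n + 1] = ps" using assms(3) by (metis map_nth)
    have "W0 S p (map ((!) ps) [0..<n + 1]) =
        (\<Sum>(zs, t)\<in>permutations_of_set (set [0..<n + 1]) \<times> trees (length [0..<n + 1] - 1).
          ev S t (map ((!) ps) zs) p)"
      using assms(3-5) by (intro W0_eq_sum_ev[OF assms(1)]) (auto simp: disjoint_iff)
    then have "W0 S p ps = (\<Sum>zs\<in>permutations_of_set {..<n + 1}. \<Sum>t\<in>trees n. ev S t (map ((!) ps) zs) p)"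
      unfolding ps set_upt length_upt lessThan_atLeast0 by (simp del: upt_Suc add: sum.cartesian_product)
    \<comment> \<open>Orderings of positions become permutations, and reading off the entries of
      \<open>ps\<close> at them is \<open>permute_list\<close>.\<close>
    also have "\<dots> = (\<Sum>\<sigma> | \<sigma> permutes {..<n + 1}. \<Sum>t\<in>trees n. ev S t (map ((!) ps) (map \<sigma> [0..<n + 1])) p)"
      by (rule sum_permutes_eq_sum_permutations_of_set[symmetric])
    also have "\<dots> = (\<Sum>\<sigma> | \<sigma> permutes {..<n + 1}. \<Sum>t\<in>trees n. of_rat (?c t) * ev S t (permute_list \<sigma> ps) p)"
      using assms(3) by (intro sum.cong refl) (simp add: c permute_list_def o_def)
    finally show ?thesis .
  qed
  ultimately show ?thesis unfolding Let_def by blast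
qed

end
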